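(* Let $\{x_k\}_{k\ge1}$ be the infinite sequence of iterates of the SZO-QQ algorithm with its termination conditions removed, and suppose that it has an accumulation point $x_c$ at which LICQ holds, i.e. the gradients $\nabla f_i(x_c)$, $i\in\{i\in\{1,\dots,m\}: f_i(x_c)=0\}$, are linearly independent. Let $\eta>0$ and let the parameter $\xi$ of the algorithm be $$\xi=h(\eta):=\min\Big\{\frac{\eta}{60\Lambda\sum_{i=1}^mM_i},\ \frac{\eta}{12\mu},\ 1,\ \frac{\eta}{4\Lambda(\alpha_{\max}+2L_{\max}+2M_{\max})}\Big\}.$$ Then the output $(\tilde x,\tilde\lambda)$ of the SZO-QQ algorithm (when it terminates) is an $\eta$-KKT pair of the problem $\min_{x\in\Omega}f_0(x)$.
   Context: Problem. Let $d,m\ge1$, let $f_0,\dots,f_m:\mathbb{R}^d\to\mathbb{R}$ be continuously differentiable with $f_0$ linear, and $\Omega=\{x\in\mathbb{R}^d: f_i(x)\le0,\ i=1,\dots,m\}$. The problem is $\min_{x\in\Omega}f_0(x)$. $\|\cdot\|$ is the Euclidean norm, $e_j$ the standard basis vectors. Standing assumptions. (1) There are constants $L_i,M_i>0$ ($i=0,\dots,m$) and a set $\overline\Omega\supset\Omega$ such that for all $x_1,x_2\in\overline\Omega$: $|f_i(x_1)-f_i(x_2)|\le L_i\|x_1-x_2\|$ and $\|\nabla f_i(x_1)-\nabla f_i(x_2)\|\le M_i\|x_1-x_2\|$; moreover $L_i>L_{i,\inf}$ and $M_i>M_{i,\inf}$, the infima of the constants for which these inequalities hold for all $x_1,x_2\in\Omega$.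 (2) $x_0$ is a given strictly feasible point: $f_i(x_0)<0$ for $i=1,\dots,m$. (3) There is $\beta\in\mathbb{R}$ such that $\{x\in\Omega: f_0(x)\le\beta\}$ is bounded and contains $x_0$. SZO-QQ iterates. Fix parameters $\mu,\Lambda,\eta,\xi>0$. Let $L_{\max}=\max_{1\le i\le m}L_i$, $M_{\max}=\max_{1\le i\le m}M_i$, $\alpha_i=\sqrt d\,M_i/2$, $\alpha_{\max}=\max_{1\le i\le m}\alpha_i$, and $\nabla^{\nu}f_i(x)=\sum_{j=1}^d\frac{f_i(x+\nu e_j)-f_i(x)}{\nu}e_j$. For $k\ge0$, given $x_k$, put $l_k^*=\min_{1\le i\le m}(-f_i(x_k))/L_{\max}$, $\nu_k^*=\min\{l_k^*/\sqrt d,\ 1/\max\{k,1\},\ \eta/(12\alpha_{\max}m\Lambda)\}$, $$\mathcal{S}^{(k)}(x_k)=\bigcap_{i=1}^m\{x: f_i(x_k)+\nabla^{\nu_k^*}f_i(x_k)^\top(x-x_k)+2M_i\|x-x_k\|^2\le0\},$$ and let $x_{k+1}$ be the minimizer of $f_0(x)+\mu\|x-x_k\|^2$ over $x\in\mathcal{S}^{(k)}(x_k)$. Termination conditions. For $\lambda\in\mathbb{R}^m_{\ge0}$ let $$\delta_1(k,\lambda)=\Big\|\nabla f_0(x_{k+1})+2\mu(x_{k+1}-x_k)+\sum_{i=1}^m\lambda^{(i)}\big(\nabla^{\nu_k^*}f_i(x_k)+4M_i(x_{k+1}-x_k)\big)\Big\|,$$ $$\delta_2^{(i)}(k,\lambda)=\Big|\lambda^{(i)}\big(f_i(x_k)+\nabla^{\nu_k^*}f_i(x_k)^\top(x_{k+1}-x_k)+2M_i\|x_{k+1}-x_k\|^2\big)\Big|.$$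 After computing $x_{k+1}$, if $\|x_{k+1}-x_k\|\le\xi$, let $\lambda_{k+1}$ be a minimizer of $\|\lambda\|_\infty$ over $\lambda\in\mathbb{R}^m_{\ge0}$ subject to $\max\{\delta_1(k,\lambda),\max_{1\le i\le m}\delta_2^{(i)}(k,\lambda)\}\le\eta/2$; if moreover $\|\lambda_{k+1}\|_\infty\le2\Lambda$, the algorithm stops and outputs $\tilde x=x_{k+1}$, $\tilde\lambda=\lambda_{k+1}$, $\tilde k=k+1$. Otherwise $k$ is increased by one and the loop continues. $\eta$-KKT pair. $(x,\lambda)\in\Omega\times\mathbb{R}^m_{\ge0}$ is an $\eta$-KKT pair of $\min_{x\in\Omega}f_0(x)$ if $\|\nabla f_0(x)+\sum_{i=1}^m\lambda^{(i)}\nabla f_i(x)\|\le\eta$ and $|\lambda^{(i)}f_i(x)|\le\eta$ for $i=1,\dots,m$. *)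

theory Defs
  imports "HOL-Analysis.Analysis"
begin

text \<open>
  The dimension is d = \<open>CARD('n)\<close> and the number of constraints is m = \<open>CARD('m)\<close>, both of
  which are automatically at least 1. The objective \<open>f0\<close> is kept apart from the family
  \<open>f\<close> of constraint functions, and likewise its constants \<open>L0\<close>, \<open>M0\<close> from \<open>L\<close>, \<open>M\<close>.
\<close>

definition gradient :: "('a::real_inner \<Rightarrow> real) \<Rightarrow> 'a \<Rightarrow> 'a" where
  "gradient g x = (THE D. GDERIV g x :> D)"

definition continuously_differentiable :: "('a::real_inner \<Rightarrow> real) \<Rightarrow> bool" where
  "continuously_differentiable g \<longleftrightarrow>
     (\<forall>x. g differentiable (at x)) \<and> continuous_on UNIV (gradient g)"

lemma gradient_eqI:
  assumes "GDERIV g x :> D"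
  shows "gradient g x = D"
  unfolding gradient_def
proof (rule the_equality)
  fix E assume "GDERIV g x :> E"
  with assms have "(\<lambda>h. inner h E) = (\<lambda>h. inner h D)"
    unfolding gderiv_def by (metis has_derivative_unique)
  then have "inner h (E - D) = 0" for h
    by (metis inner_diff_right right_minus_eq)
  from this[of "E - D"] show "E = D" by simp
qed (rule assms)

lemma gradient_works:
  fixes g :: "'a::euclidean_space \<Rightarrow> real"
  assumes "g differentiable (at x)"
  shows "GDERIV g x :> gradient g x"
proof -
  from assms obtain F where F: "(g has_derivative F) (at x)"
    unfolding differentiable_def by blast
  then have "linear F" by (rule has_derivative_linear)
  then have "F = (\<lambda>h. inner h (adjoint F 1))"
    using adjoint_works[of F _ 1] by (simp add: fun_eq_iff)
  with F have "GDERIV g x :> adjoint F 1"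
    unfolding gderiv_def by simp
  then show ?thesis using gradient_eqI by metis
qed

definition feasible_set :: "('m \<Rightarrow> 'a \<Rightarrow> real) \<Rightarrow> 'a set" where
  "feasible_set f = {x. \<forall>i. f i x \<le> 0}"

text \<open>
  \<open>L\<close> and \<open>M\<close> are Lipschitz constants of \<open>g\<close> and of its gradient on \<open>S\<close>, strictly larger
  than the infima of all such constants on the smaller set \<open>\<Omega>\<close>.
\<close>

definition smoothness_constants ::
    "'a::real_inner set \<Rightarrow> 'a set \<Rightarrow> ('a \<Rightarrow> real) \<Rightarrow> real \<Rightarrow> real \<Rightarrow> bool" where
  "smoothness_constants \<Omega> S g L M \<longleftrightarrow>
     0 < L \<and> 0 < M \<and>
     L-lipschitz_on S g \<and> M-lipschitz_on S (gradient g) \<and>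
     L > Inf {C. C-lipschitz_on \<Omega> g} \<and>
     M > Inf {C. C-lipschitz_on \<Omega> (gradient g)}"

definition LICQ :: "('m \<Rightarrow> 'a::real_inner \<Rightarrow> real) \<Rightarrow> 'a \<Rightarrow> bool" where
  "LICQ f x \<longleftrightarrow>
     inj_on (\<lambda>i. gradient (f i) x) {i. f i x = 0} \<and>
     independent ((\<lambda>i. gradient (f i) x) ` {i. f i x = 0})"

definition accumulation_point :: "(nat \<Rightarrow> 'a::topological_space) \<Rightarrow> 'a \<Rightarrow> bool" where
  "accumulation_point X x \<longleftrightarrow> (\<exists>r. strict_mono r \<and> (X \<circ> r) \<longlonglongrightarrow> x)"

definition eta_KKT_pair ::
    "real \<Rightarrow> ('a::real_inner \<Rightarrow> real) \<Rightarrow> ('m::finite \<Rightarrow> 'a \<Rightarrow> real) \<Rightarrow> 'a \<Rightarrow> real^'m \<Rightarrow> bool" where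
  "eta_KKT_pair \<eta> f0 f x lam \<longleftrightarrow>
     x \<in> feasible_set f \<and> (\<forall>i. 0 \<le> lam $ i) \<and>
     norm (gradient f0 x + (\<Sum>i\<in>UNIV. (lam $ i) *\<^sub>R gradient (f i) x)) \<le> \<eta> \<and>
     (\<forall>i. \<bar>lam $ i * f i x\<bar> \<le> \<eta>)"

definition fd_gradient :: "real \<Rightarrow> (real^'n \<Rightarrow> real) \<Rightarrow> real^'n \<Rightarrow> real^'n" where
  "fd_gradient \<nu> g x = (\<Sum>j\<in>UNIV. ((g (x + \<nu> *\<^sub>R axis j 1) - g x) / \<nu>) *\<^sub>R axis j 1)"

definition max_const :: "('m::finite \<Rightarrow> real) \<Rightarrow> real" where
  "max_const L = Max (range L)"

text \<open>The first argument of \<open>alpha_max\<close> is the dimension d of the space.\<close>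

definition alpha_max :: "nat \<Rightarrow> ('m::finite \<Rightarrow> real) \<Rightarrow> real" where
  "alpha_max d M = Max (range (\<lambda>i. sqrt (real d) * M i / 2))"

definition l_star :: "('m::finite \<Rightarrow> 'a \<Rightarrow> real) \<Rightarrow> ('m \<Rightarrow> real) \<Rightarrow> 'a \<Rightarrow> real" where
  "l_star f L x = Min (range (\<lambda>i. - f i x)) / max_const L"

definition nu_star ::
    "('m::finite \<Rightarrow> real^'n \<Rightarrow> real) \<Rightarrow> ('m \<Rightarrow> real) \<Rightarrow> ('m \<Rightarrow> real) \<Rightarrow> real \<Rightarrow> real \<Rightarrow>
     nat \<Rightarrow> real^'n \<Rightarrow> real" where
  "nu_star f L M \<Lambda> \<eta> k x =
     Min {l_star f L x / sqrt (real CARD('n)),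
          1 / real (max k 1),
          \<eta> / (12 * alpha_max CARD('n) M * real CARD('m) * \<Lambda>)}"

definition local_model ::
    "(real^'n \<Rightarrow> real) \<Rightarrow> real \<Rightarrow> real \<Rightarrow> real^'n \<Rightarrow> real^'n \<Rightarrow> real" where
  "local_model g Mg \<nu> x y =
     g x + inner (fd_gradient \<nu> g x) (y - x) + 2 * Mg * (norm (y - x))\<^sup>2"

definition local_feasible_set ::
    "('m \<Rightarrow> real^'n \<Rightarrow> real) \<Rightarrow> ('m \<Rightarrow> real) \<Rightarrow> real \<Rightarrow> real^'n \<Rightarrow> (real^'n) set" where
  "local_feasible_set f M \<nu> x = (\<Inter>i. {y. local_model (f i) (M i) \<nu> x y \<le> 0})"

text \<open>\<open>y\<close> is an admissible successor of the \<open>k\<close>-th iterate \<open>x\<close>.\<close>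

definition szo_qq_step ::
    "(real^'n \<Rightarrow> real) \<Rightarrow> ('m::finite \<Rightarrow> real^'n \<Rightarrow> real) \<Rightarrow> ('m \<Rightarrow> real) \<Rightarrow> ('m \<Rightarrow> real) \<Rightarrow>
     real \<Rightarrow> real \<Rightarrow> real \<Rightarrow> nat \<Rightarrow> real^'n \<Rightarrow> real^'n \<Rightarrow> bool" where
  "szo_qq_step f0 f L M \<mu> \<Lambda> \<eta> k x y \<longleftrightarrow>
     is_arg_min (\<lambda>z. f0 z + \<mu> * (norm (z - x))\<^sup>2)
       (\<lambda>z. z \<in> local_feasible_set f M (nu_star f L M \<Lambda> \<eta> k x) x) y"

text \<open>The infinite sequence of iterates generated without termination conditions.\<close>

definition szo_qq_iterates ::
    "(real^'n \<Rightarrow> real) \<Rightarrow> ('m::finite \<Rightarrow> real^'n \<Rightarrow> real) \<Rightarrow> ('m \<Rightarrow> real) \<Rightarrow> ('m \<Rightarrow> real) \<Rightarrow>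
     real \<Rightarrow> real \<Rightarrow> real \<Rightarrow> real^'n \<Rightarrow> (nat \<Rightarrow> real^'n) \<Rightarrow> bool" where
  "szo_qq_iterates f0 f L M \<mu> \<Lambda> \<eta> x0 X \<longleftrightarrow>
     X 0 = x0 \<and> (\<forall>k. szo_qq_step f0 f L M \<mu> \<Lambda> \<eta> k (X k) (X (Suc k)))"

text \<open>In the following, \<open>x\<close> and \<open>y\<close> are two consecutive iterates.\<close>

definition delta1 ::
    "(real^'n \<Rightarrow> real) \<Rightarrow> ('m::finite \<Rightarrow> real^'n \<Rightarrow> real) \<Rightarrow> ('m \<Rightarrow> real) \<Rightarrow>
     real \<Rightarrow> real \<Rightarrow> real^'n \<Rightarrow> real^'n \<Rightarrow> real^'m \<Rightarrow> real" where
  "delta1 f0 f M \<mu> \<nu> x y lam =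
     norm (gradient f0 y + (2 * \<mu>) *\<^sub>R (y - x) +
       (\<Sum>i\<in>UNIV. (lam $ i) *\<^sub>R (fd_gradient \<nu> (f i) x + (4 * M i) *\<^sub>R (y - x))))"

definition delta2 ::
    "('m::finite \<Rightarrow> real^'n \<Rightarrow> real) \<Rightarrow> ('m \<Rightarrow> real) \<Rightarrow>
     real \<Rightarrow> real^'n \<Rightarrow> real^'n \<Rightarrow> real^'m \<Rightarrow> 'm \<Rightarrow> real" where
  "delta2 f M \<nu> x y lam i = \<bar>lam $ i * local_model (f i) (M i) \<nu> x y\<bar>"

definition szo_qq_multiplier ::
    "(real^'n \<Rightarrow> real) \<Rightarrow> ('m::finite \<Rightarrow> real^'n \<Rightarrow> real) \<Rightarrow> ('m \<Rightarrow> real) \<Rightarrow>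
     real \<Rightarrow> real \<Rightarrow> real \<Rightarrow> real^'n \<Rightarrow> real^'n \<Rightarrow> real^'m \<Rightarrow> bool" where
  "szo_qq_multiplier f0 f M \<mu> \<eta> \<nu> x y lam \<longleftrightarrow>
     is_arg_min infnorm
       (\<lambda>l. (\<forall>i. 0 \<le> l $ i) \<and>
            max (delta1 f0 f M \<mu> \<nu> x y l) (Max (range (delta2 f M \<nu> x y l))) \<le> \<eta> / 2) lam"

text \<open>
  All minimizers of the multiplier problem have the same norm, so whether the loop stops after
  computing \<open>y\<close> does not depend on which of them is chosen. If that problem is infeasible,
  no multiplier exists and the loop continues.
\<close>

definition szo_qq_stops ::
    "(real^'n \<Rightarrow> real) \<Rightarrow> ('m::finite \<Rightarrow> real^'n \<Rightarrow> real) \<Rightarrow> ('m \<Rightarrow> real) \<Rightarrow> ('m \<Rightarrow> real) \<Rightarrow>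
     real \<Rightarrow> real \<Rightarrow> real \<Rightarrow> real \<Rightarrow> nat \<Rightarrow> real^'n \<Rightarrow> real^'n \<Rightarrow> real^'m \<Rightarrow> bool" where
  "szo_qq_stops f0 f L M \<mu> \<Lambda> \<eta> \<xi> k x y lam \<longleftrightarrow>
     norm (y - x) \<le> \<xi> \<and>
     szo_qq_multiplier f0 f M \<mu> \<eta> (nu_star f L M \<Lambda> \<eta> k x) x y lam \<and>
     infnorm lam \<le> 2 * \<Lambda>"

text \<open>The algorithm started at \<open>x0\<close> terminates with output \<open>xt\<close>, \<open>lamt\<close>, \<open>kt\<close>.\<close>

definition szo_qq_output ::
    "(real^'n \<Rightarrow> real) \<Rightarrow> ('m::finite \<Rightarrow> real^'n \<Rightarrow> real) \<Rightarrow> ('m \<Rightarrow> real) \<Rightarrow> ('m \<Rightarrow> real) \<Rightarrow>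
     real \<Rightarrow> real \<Rightarrow> real \<Rightarrow> real \<Rightarrow> real^'n \<Rightarrow> real^'n \<Rightarrow> real^'m \<Rightarrow> nat \<Rightarrow> bool" where
  "szo_qq_output f0 f L M \<mu> \<Lambda> \<eta> \<xi> x0 xt lamt kt \<longleftrightarrow>
     (\<exists>Y k. Y 0 = x0 \<and>
        (\<forall>j\<le>k. szo_qq_step f0 f L M \<mu> \<Lambda> \<eta> j (Y j) (Y (Suc j))) \<and>
        (\<forall>j<k. \<not> (\<exists>lam. szo_qq_stops f0 f L M \<mu> \<Lambda> \<eta> \<xi> j (Y j) (Y (Suc j)) lam)) \<and>
        szo_qq_stops f0 f L M \<mu> \<Lambda> \<eta> \<xi> k (Y k) (Y (Suc k)) lamt \<and>
        xt = Y (Suc k) \<and> kt = Suc k)"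

text \<open>As for \<open>alpha_max\<close>, the argument \<open>d\<close> is the dimension of the space.\<close>

definition h_threshold ::
    "nat \<Rightarrow> ('m::finite \<Rightarrow> real) \<Rightarrow> ('m \<Rightarrow> real) \<Rightarrow> real \<Rightarrow> real \<Rightarrow> real \<Rightarrow> real" where
  "h_threshold d L M \<mu> \<Lambda> \<eta> =
     Min {\<eta> / (60 * \<Lambda> * (\<Sum>i\<in>UNIV. M i)),
          \<eta> / (12 * \<mu>),
          1,
          \<eta> / (4 * \<Lambda> * (alpha_max d M + 2 * max_const L + 2 * max_const M))}"

end

theory Submission
  imports Defs
begin

text \<open>
  A minimizer of a local model stays strictly feasible: on a segment leaving a strictly feasible
  point, consider the first point at which some constraint fails to be negative. Up to there the
  segment lies in the (possibly non-convex) feasible set, so the Lipschitz bounds apply along it.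
  Within distance \<open>l_star\<close> the Lipschitz constants of the constraints, and beyond it the term
  \<open>2 * M i * (norm _)\<^sup>2\<close> of the model, which absorbs both the Taylor remainder and the
  finite-difference error, force all constraints to be negative, a contradiction.
  The termination residuals then differ from the KKT residuals by errors of the order of the step
  length and of the sampling radius, and these are bounded by \<open>h_threshold\<close> and \<open>nu_star\<close>.
\<close>

section \<open>Taylor bounds from a Lipschitz gradient\<close>

text \<open>Along the segment, \<open>\<phi>\<close> is \<open>g\<close> minus its linear part and
  the claimed quadratic bound; Cauchy-Schwarz makes its derivative nonpositive. The hypotheses are
  symmetric under \<open>g\<close> to \<open>- g\<close>, so a lower bound comes from the same
  lemma.\<close>

lemma gradient_lipschitz_taylor_upper:
  fixes g :: "'a::euclidean_space \<Rightarrow> real"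
  assumes diff: "\<And>p. p \<in> closed_segment x z \<Longrightarrow> g differentiable (at p)"
    and lip: "\<And>p. p \<in> closed_segment x z \<Longrightarrow>
                norm (gradient g p - gradient g x) \<le> C * norm (p - x)"
  shows "g z - g x - inner (gradient g x) (z - x) \<le> C / 2 * (norm (z - x))\<^sup>2"
proof -
  define \<phi> where "\<phi> t = g (x + t *\<^sub>R (z - x)) - t * inner (gradient g x) (z - x)
                        - C / 2 * t\<^sup>2 * (norm (z - x))\<^sup>2" for t
  have "\<phi> 1 \<le> \<phi> 0"
  proof (rule DERIV_nonpos_imp_nonincreasing[of 0 1])
    fix t :: real assume t: "0 \<le> t" "t \<le> 1"
    define p where "p = x + t *\<^sub>R (z - x)"
    have p: "p \<in> closed_segment x z"
      using t unfolding p_def in_segment by (intro exI[of _ t]) (simp add: algebra_simps)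
    have "(g has_derivative (\<lambda>h. inner h (gradient g p))) (at (x + t *\<^sub>R (z - x)))"
      using gradient_works[OF diff[OF p]] unfolding gderiv_def p_def .
    moreover have "((\<lambda>t. x + t *\<^sub>R (z - x)) has_derivative (\<lambda>h. h *\<^sub>R (z - x))) (at t)"
      by (auto intro!: derivative_eq_intros)
    ultimately have "((\<lambda>t. g (x + t *\<^sub>R (z - x))) has_derivative
        (\<lambda>h. inner (h *\<^sub>R (z - x)) (gradient g p))) (at t)"
      by (rule has_derivative_compose[rotated])
    then have "((\<lambda>t. g (x + t *\<^sub>R (z - x))) has_real_derivative
        inner (gradient g p) (z - x)) (at t)"
      unfolding has_field_derivative_def by (simp add: inner_commute mult_commute_abs)
    then have "(\<phi> has_real_derivative (inner (gradient g p) (z - x)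
        - inner (gradient g x) (z - x) - C * t * (norm (z - x))\<^sup>2)) (at t)"
      unfolding \<phi>_def by (auto intro!: derivative_eq_intros)
    moreover have "inner (gradient g p) (z - x) - inner (gradient g x) (z - x)
        \<le> C * t * (norm (z - x))\<^sup>2"
    proof -
      have "inner (gradient g p - gradient g x) (z - x)
          \<le> norm (gradient g p - gradient g x) * norm (z - x)"
        by (rule norm_cauchy_schwarz)
      also have "\<dots> \<le> (C * norm (p - x)) * norm (z - x)"
        by (rule mult_right_mono[OF lip[OF p]]) simp
      also have "norm (p - x) = t * norm (z - x)"
        using t by (simp add: p_def)
      finally show ?thesis
        by (simp add: inner_diff_left power2_eq_square mult.assoc)
    qed
    ultimately show "\<exists>y. (\<phi> has_real_derivative y) (at t) \<and> y \<le> 0"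
      by (intro exI conjI) (assumption, simp)
  qed simp
  then show ?thesis by (simp add: \<phi>_def)
qed

lemma gradient_uminus:
  fixes g :: "'a::euclidean_space \<Rightarrow> real"
  assumes "g differentiable (at x)"
  shows "gradient (\<lambda>p. - g p) x = - gradient g x"
  using gradient_works[OF assms] by (intro gradient_eqI GDERIV_minus)

text \<open>The one-sided bound, applied to \<open>g\<close> and to \<open>- g\<close>. Containment
  of the segment stands in for convexity of \<open>S\<close>, which the feasible set need not
  have.\<close>

lemma gradient_lipschitz_taylor:
  fixes g :: "'a::euclidean_space \<Rightarrow> real"
  assumes diff: "\<And>p. g differentiable (at p)"
    and lip: "C-lipschitz_on S (gradient g)"
    and seg: "closed_segment x z \<subseteq> S"
  shows "\<bar>g z - g x - inner (gradient g x) (z - x)\<bar> \<le> C / 2 * (norm (z - x))\<^sup>2"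
proof -
  have *: "norm (gradient g p - gradient g x) \<le> C * norm (p - x)"
    if "p \<in> closed_segment x z" for p
    using lipschitz_onD[OF lip, of p x] that seg ends_in_segment(1)[of x z]
    by (auto simp: dist_norm)
  have "g z - g x - inner (gradient g x) (z - x) \<le> C / 2 * (norm (z - x))\<^sup>2"
    using diff * by (rule gradient_lipschitz_taylor_upper)
  moreover have "- g z - - g x - inner (gradient (\<lambda>p. - g p) x) (z - x)
      \<le> C / 2 * (norm (z - x))\<^sup>2"
    using diff * by (intro gradient_lipschitz_taylor_upper)
      (auto simp: gradient_uminus norm_minus_commute intro: differentiable_minus)
  ultimately show ?thesis
    unfolding gradient_uminus[OF diff] inner_minus_left abs_le_iff by linarith
qed

section \<open>Accuracy of the finite-difference gradient\<close>

lemma norm_le_sqrt_card_cart: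
  fixes v :: "real^'n"
  assumes "\<And>j. \<bar>v $ j\<bar> \<le> c"
  shows "norm v \<le> sqrt (real CARD('n)) * c"
proof -
  have "0 \<le> c" using assms[of undefined] by linarith
  have "(\<Sum>j\<in>UNIV. (v $ j)\<^sup>2) \<le> real CARD('n) * c\<^sup>2"
    using assms by (intro sum_bounded_above) (simp add: abs_le_square_iff[symmetric] \<open>0 \<le> c\<close>)
  then have "norm v \<le> sqrt (real CARD('n) * c\<^sup>2)"
    unfolding norm_vec_def L2_set_def by (simp del: real_sqrt_mult)
  then show ?thesis using \<open>0 \<le> c\<close> by (simp add: real_sqrt_mult)
qed

lemma fd_gradient_component:
  "fd_gradient \<nu> g x $ j = (g (x + \<nu> *\<^sub>R axis j 1) - g x) / \<nu>"
  unfolding fd_gradient_def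
  by (simp add: sum_component axis_def if_distrib[of "\<lambda>t. _ * t"] sum.delta cong: if_cong)

text \<open>Each component of the error is a Taylor remainder over an axis step of length
  \<open>\<nu>\<close>, divided by \<open>\<nu>\<close>. The square root of the dimension comes from
  passing from components to the Euclidean norm.\<close>

lemma fd_gradient_error:
  fixes g :: "real^'n \<Rightarrow> real"
  assumes diff: "\<And>p. g differentiable (at p)"
    and lip: "C-lipschitz_on S (gradient g)"
    and "\<nu> > 0"
    and S: "cball x \<nu> \<subseteq> S"
  shows "norm (fd_gradient \<nu> g x - gradient g x) \<le> sqrt (real CARD('n)) * C / 2 * \<nu>"
proof -
  have "\<bar>(fd_gradient \<nu> g x - gradient g x) $ j\<bar> \<le> C / 2 * \<nu>" for j
  proof -
    define z where "z = x + \<nu> *\<^sub>R (axis j 1 :: real^'n)"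
    have zx: "z - x = \<nu> *\<^sub>R axis j 1" "norm (z - x) = \<nu>"
      using \<open>\<nu> > 0\<close> by (simp_all add: z_def)
    have "z \<in> cball x \<nu>" "x \<in> cball x \<nu>"
      using zx(2) \<open>\<nu> > 0\<close> by (auto simp: dist_norm norm_minus_commute)
    then have "closed_segment x z \<subseteq> S"
      using closed_segment_subset[OF _ _ convex_cball, of x x \<nu> z] S by blast
    from gradient_lipschitz_taylor[OF diff lip this]
    have "\<bar>g z - g x - \<nu> * gradient g x $ j\<bar> \<le> C / 2 * \<nu>\<^sup>2"
      unfolding zx(2) unfolding zx(1) by (simp add: inner_axis)
    then have "\<bar>g z - g x - \<nu> * gradient g x $ j\<bar> / \<nu> \<le> C / 2 * \<nu>"
      using \<open>\<nu> > 0\<close> by (simp add: divide_le_eq power2_eq_square mult.assoc)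
    moreover have "(fd_gradient \<nu> g x - gradient g x) $ j = (g z - g x - \<nu> * gradient g x $ j) / \<nu>"
      using \<open>\<nu> > 0\<close> by (simp add: fd_gradient_component z_def field_simps)
    ultimately show ?thesis using \<open>\<nu> > 0\<close> by simp
  qed
  from norm_le_sqrt_card_cart[OF this] show ?thesis by (simp add: mult.assoc)
qed

section \<open>Quadratic models of the constraints\<close>

lemma local_model_diff:
  "local_model g C \<nu> x z - (g x + inner (gradient g x) (z - x))
     = inner (fd_gradient \<nu> g x - gradient g x) (z - x) + 2 * C * (norm (z - x))\<^sup>2"
  unfolding local_model_def by (simp add: inner_diff_left)

text \<open>The model is affine plus a nonnegative multiple of a squared distance. Convexity will
  carry the model constraint from the two ends of a step to all points between them.\<close>

lemma convex_local_model_sublevel: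
  assumes "C \<ge> 0"
  shows "convex {z. local_model g C \<nu> x z \<le> 0}"
proof -
  have sq: "convex_on UNIV (\<lambda>z. (norm (z - x))\<^sup>2)"
  proof (rule convex_onI)
    fix t :: real and a b assume t: "0 < t" "t < 1"
    \<comment> \<open>The convexity gap of the squared norm has a closed form, visibly
      nonnegative.\<close>
    have "(1 - t) * (norm (a - x))\<^sup>2 + t * (norm (b - x))\<^sup>2
        - (norm ((1 - t) *\<^sub>R a + t *\<^sub>R b - x))\<^sup>2 = t * (1 - t) * (norm (a - b))\<^sup>2"
      unfolding power2_norm_eq_inner by (simp add: algebra_simps inner_commute)
    moreover have "\<dots> \<ge> 0" using t by simp
    ultimately show "(norm ((1 - t) *\<^sub>R a + t *\<^sub>R b - x))\<^sup>2
        \<le> (1 - t) * (norm (a - x))\<^sup>2 + t * (norm (b - x))\<^sup>2" by linarith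
  qed simp
  have lin: "convex_on UNIV (\<lambda>z. g x + inner (fd_gradient \<nu> g x) (z - x))"
    by (rule convex_onI) (simp_all add: algebra_simps inner_diff_right inner_add_right)
  have "convex_on UNIV (local_model g C \<nu> x)"
    unfolding local_model_def using assms
    by (intro convex_on_add lin convex_on_cmul sq) simp
  then have "local_model g C \<nu> x (u *\<^sub>R a + v *\<^sub>R b)
      \<le> u * local_model g C \<nu> x a + v * local_model g C \<nu> x b"
    if "0 \<le> u" "0 \<le> v" "u + v = 1" for u v a b
    using that unfolding convex_on_def by blast
  then show ?thesis
    unfolding convex_def
    by (smt (verit) mem_Collect_eq mult_nonneg_nonpos)
qed


section \<open>Strict feasibility of a step\<close>

locale smooth_constraints =
  fixes f :: "'m::finite \<Rightarrow> real^'n \<Rightarrow> real" and L M :: "'m \<Rightarrow> real"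
  assumes differentiable_at: "\<And>i p. f i differentiable (at p)"
    and L_pos: "\<And>i. L i > 0" and M_pos: "\<And>i. M i > 0"
    and f_lipschitz: "\<And>i. (L i)-lipschitz_on (feasible_set f) (f i)"
    and gradient_lipschitz: "\<And>i. (M i)-lipschitz_on (feasible_set f) (gradient (f i))"
begin

lemma continuous_on_f: "continuous_on A (f i)"
  using differentiable_imp_continuous_within[OF differentiable_at]
  by (intro continuous_at_imp_continuous_on) blast

lemma closed_feasible_set: "closed (feasible_set f)"
  unfolding feasible_set_def
  by (intro closed_Collect_all closed_Collect_le) (auto intro: continuous_on_f)

text \<open>A continuation principle: \<open>step\<close> may presuppose that the segment up to
  \<open>z\<close> is feasible, which is what the Lipschitz bounds require. A violation would have a
  first point, and \<open>step\<close> excludes exactly that point.\<close>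

lemma strictly_feasible_segment:
  assumes x: "\<And>i. f i x < 0"
    and step: "\<And>z i. z \<in> closed_segment x y \<Longrightarrow> closed_segment x z \<subseteq> feasible_set f \<Longrightarrow> f i z < 0"
    and w: "w \<in> closed_segment x y"
  shows "f i w < 0"
proof (rule ccontr)
  assume "\<not> f i w < 0"
  define B where "B = closed_segment x y \<inter> {z. \<exists>i. 0 \<le> f i z}"
  have "{z. \<exists>i. 0 \<le> f i z} = (\<Union>i. {z. 0 \<le> f i z})" by blast
  then have "closed {z. \<exists>i. 0 \<le> f i z}"
    by (auto intro!: closed_UN closed_Collect_le continuous_on_f continuous_on_const)
  then have "compact B"
    unfolding B_def by (intro compact_Int_closed) simp_all
  moreover have "w \<in> B" using w \<open>\<not> f i w < 0\<close> by (auto simp: B_def not_less)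
  \<comment> \<open>The violating point nearest to \<open>x\<close> is the first one met along the
    segment.\<close>
  ultimately obtain z where z: "z \<in> B" and min: "\<And>p. p \<in> B \<Longrightarrow> dist x z \<le> dist x p"
    using continuous_attains_inf[of B "dist x"] continuous_on_dist[OF continuous_on_const continuous_on_id]
    by blast
  have "x \<noteq> z" using z x by (auto simp: B_def not_le[symmetric])
  have zs: "z \<in> closed_segment x y" using z by (simp add: B_def)
  have "open_segment x z \<subseteq> feasible_set f"
  proof
    fix p assume p: "p \<in> open_segment x z"
    then have "dist x p < dist x z"
      using dist_in_open_segment[OF p] by (simp add: dist_commute)
    then have "p \<notin> B" using min[of p] by force
    moreover have "p \<in> closed_segment x y"
      using p zs by (meson ends_in_segment(1) open_closed_segment subset_closed_segment subsetD)
    ultimately show "p \<in> feasible_set f"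
      by (auto simp: B_def feasible_set_def not_le intro: less_imp_le)
  qed
  \<comment> \<open>Taking closures adds the endpoint \<open>z\<close> itself, where some constraint
    is not negative.\<close>
  then have "closed_segment x z \<subseteq> feasible_set f"
    using closure_minimal[OF _ closed_feasible_set] \<open>x \<noteq> z\<close>
    by (metis closure_open_segment)
  from step[OF zs this] show False using z by (auto simp: B_def not_less[symmetric])
qed

lemma L_le_max: "L i \<le> max_const L"
  unfolding max_const_def by (rule Max_ge) auto

lemma max_const_L_pos: "max_const L > 0"
  using L_pos L_le_max by (metis less_le_trans)

lemma l_star_le: "max_const L * l_star f L x \<le> - f i x"
  unfolding l_star_def using max_const_L_pos by (simp add: Min_le)

lemma l_star_pos:
  assumes "\<And>i. f i x < 0"
  shows "l_star f L x > 0"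
  unfolding l_star_def using assms max_const_L_pos by (auto intro!: divide_pos_pos)

text \<open>Within this radius no constraint can rise by its whole slack at \<open>x\<close>. The
  Lipschitz bound holds only on the feasible set, hence the detour through the continuation
  principle.\<close>

lemma strictly_feasible_ball:
  assumes x: "\<And>i. f i x < 0" and z: "norm (z - x) < l_star f L x"
  shows "f i z < 0"
proof (rule strictly_feasible_segment[OF x _ ends_in_segment(2)])
  fix w i assume w: "w \<in> closed_segment x z" and seg: "closed_segment x w \<subseteq> feasible_set f"
  have "norm (w - x) \<le> norm (z - x)"
    using segment_bound(1)[OF w] by simp
  then have "L i * norm (w - x) \<le> max_const L * norm (z - x)"
    using L_le_max L_pos max_const_L_pos by (intro mult_mono) (auto intro: less_imp_le)
  also have "\<dots> < max_const L * l_star f L x"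
    using z max_const_L_pos by simp
  also have "\<dots> \<le> - f i x" by (rule l_star_le)
  finally have "L i * norm (w - x) < - f i x" .
  moreover have "\<bar>f i w - f i x\<bar> \<le> L i * norm (w - x)"
    using lipschitz_onD[OF f_lipschitz, of w x i] seg by (auto simp: dist_norm)
  ultimately show "f i w < 0" by linarith
qed

text \<open>The closed ball is needed because in dimension one the sampling radius may equal
  \<open>l_star f L x\<close>.\<close>

lemma cball_l_star_feasible:
  assumes x: "\<And>i. f i x < 0"
  shows "cball x (l_star f L x) \<subseteq> feasible_set f"
proof -
  have "ball x (l_star f L x) \<subseteq> feasible_set f"
    using strictly_feasible_ball[OF x]
    by (force simp: feasible_set_def dist_norm norm_minus_commute intro: less_imp_le)
  then show ?thesis
    using closure_minimal[OF _ closed_feasible_set] l_star_pos[OF x] by (metis closure_ball)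
qed

lemma fd_gradient_constraint_error:
  assumes x: "\<And>i. f i x < 0"
    and \<nu>: "0 < \<nu>" "sqrt (real CARD('n)) * \<nu> \<le> l_star f L x"
  shows "norm (fd_gradient \<nu> (f i) x - gradient (f i) x) \<le> sqrt (real CARD('n)) * M i / 2 * \<nu>"
proof (rule fd_gradient_error[OF differentiable_at gradient_lipschitz \<nu>(1)])
  have "1 * \<nu> \<le> sqrt (real CARD('n)) * \<nu>"
    using \<nu>(1) by (intro mult_right_mono) (auto simp: Suc_leI)
  then have "\<nu> \<le> l_star f L x" using \<nu>(2) by simp
  then show "cball x \<nu> \<subseteq> feasible_set f"
    using cball_l_star_feasible[OF x] subset_cball by blast
qed

text \<open>Adding \<open>2 * M i * (norm (z - x))\<^sup>2\<close> to \<open>f i z\<close> cancels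
  the quadratic term of the model, leaving the Taylor remainder and the finite-difference error. The
  upper estimate gives feasibility, the two-sided one complementarity.\<close>

lemma model_error:
  assumes x: "\<And>i. f i x < 0"
    and \<nu>: "0 < \<nu>" "sqrt (real CARD('n)) * \<nu> \<le> l_star f L x"
    and seg: "closed_segment x z \<subseteq> feasible_set f"
  shows "\<bar>f i z + 2 * M i * (norm (z - x))\<^sup>2 - local_model (f i) (M i) \<nu> x z\<bar>
    \<le> sqrt (real CARD('n)) * M i / 2 * \<nu> * norm (z - x) + M i / 2 * (norm (z - x))\<^sup>2"
proof -
  define e where "e = fd_gradient \<nu> (f i) x - gradient (f i) x"
  have "\<bar>inner e (z - x)\<bar> \<le> norm e * norm (z - x)"
    by (rule Cauchy_Schwarz_ineq2)
  also have "\<dots> \<le> sqrt (real CARD('n)) * M i / 2 * \<nu> * norm (z - x)"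
    unfolding e_def by (intro mult_right_mono fd_gradient_constraint_error[OF x \<nu>]) simp
  finally show ?thesis
    using gradient_lipschitz_taylor[OF differentiable_at gradient_lipschitz seg, of i]
      local_model_diff[of "f i" "M i" \<nu> x z]
    unfolding e_def by linarith
qed

text \<open>Near \<open>x\<close> the Lipschitz ball suffices. Farther away
  \<open>sqrt (real CARD('n)) * \<nu>\<close> is at most \<open>norm (z - x)\<close>, so the two
  model errors take at most half of the quadratic term and \<open>f i z\<close> is at most
  \<open>- M i * (norm (z - x))\<^sup>2\<close>.\<close>

lemma strictly_feasible_local_feasible_set:
  assumes x: "\<And>i. f i x < 0"
    and \<nu>: "0 < \<nu>" "sqrt (real CARD('n)) * \<nu> \<le> l_star f L x"
    and y: "y \<in> local_feasible_set f M \<nu> x"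
    and w: "w \<in> closed_segment x y"
  shows "f i w < 0"
proof (rule strictly_feasible_segment[OF x _ w])
  fix z i assume z: "z \<in> closed_segment x y" and seg: "closed_segment x z \<subseteq> feasible_set f"
  show "f i z < 0"
  proof (cases "norm (z - x) < l_star f L x")
    case True
    then show ?thesis by (rule strictly_feasible_ball[OF x])
  next
    case False
    \<comment> \<open>Both ends satisfy the model constraint, so by convexity \<open>z\<close> does
      too.\<close>
    have "x \<in> {z. local_model (f i) (M i) \<nu> x z \<le> 0}"
      using x[of i] by (simp add: local_model_def)
    moreover have "y \<in> {z. local_model (f i) (M i) \<nu> x z \<le> 0}"
      using y by (auto simp: local_feasible_set_def)
    ultimately have "closed_segment x y \<subseteq> {z. local_model (f i) (M i) \<nu> x z \<le> 0}"
      using M_pos[of i]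
      by (intro closed_segment_subset convex_local_model_sublevel less_imp_le)
    then have "local_model (f i) (M i) \<nu> x z \<le> 0"
      using z by blast
    moreover have "sqrt (real CARD('n)) * M i / 2 * \<nu> * norm (z - x)
        \<le> M i / 2 * (norm (z - x))\<^sup>2"
    proof -
      have "sqrt (real CARD('n)) * \<nu> \<le> norm (z - x)" using False \<nu>(2) by linarith
      then have "M i / 2 * norm (z - x) * (sqrt (real CARD('n)) * \<nu>)
          \<le> M i / 2 * norm (z - x) * norm (z - x)"
        using M_pos[of i] by (intro mult_left_mono) auto
      then show ?thesis by (simp add: power2_eq_square mult_ac)
    qed
    moreover have "M i * (norm (z - x))\<^sup>2 > 0"
    proof (rule mult_pos_pos)
      have "0 < norm (z - x)" using False l_star_pos[OF x] by linarith
      then show "(norm (z - x))\<^sup>2 > 0" by (rule zero_less_power)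
    qed (rule M_pos)
    ultimately show ?thesis
      using model_error[OF x \<nu> seg, of i] by linarith
  qed
qed

section \<open>Bounds on the sampling radius\<close>

lemma alpha_le_max: "sqrt (real d) * M i / 2 \<le> alpha_max d M"
  unfolding alpha_max_def by (rule Max_ge) auto

lemma alpha_max_pos: "d > 0 \<Longrightarrow> alpha_max d M > 0"
  using M_pos[of undefined] by (intro less_le_trans[OF _ alpha_le_max[of d undefined]]) simp

text \<open>The second bound keeps the sampling points in the feasible ball; the third limits the
  finite-difference error, summed over all constraints with multipliers up to
  \<open>2 * \<Lambda>\<close>, to \<open>\<eta> / 6\<close>.\<close>

lemma nu_star_bounds:
  assumes x: "\<And>i. f i x < 0" and "\<Lambda> > 0" "\<eta> > 0"
  shows "0 < nu_star f L M \<Lambda> \<eta> k x"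
    and "sqrt (real CARD('n)) * nu_star f L M \<Lambda> \<eta> k x \<le> l_star f L x"
    and "12 * alpha_max CARD('n) M * real CARD('m) * \<Lambda> * nu_star f L M \<Lambda> \<eta> k x \<le> \<eta>"
proof -
  let ?\<nu> = "nu_star f L M \<Lambda> \<eta> k x"
  have pos: "12 * alpha_max CARD('n) M * real CARD('m) * \<Lambda> > 0"
    using alpha_max_pos[of "CARD('n)"] \<open>\<Lambda> > 0\<close> by simp
  show "0 < ?\<nu>"
    unfolding nu_star_def using l_star_pos[OF x] pos \<open>\<eta> > 0\<close>
    by (auto intro!: divide_pos_pos)
  have "?\<nu> \<le> l_star f L x / sqrt (real CARD('n))"
    unfolding nu_star_def by (rule Min_le) auto
  then show "sqrt (real CARD('n)) * ?\<nu> \<le> l_star f L x"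
    by (simp add: pos_le_divide_eq mult.commute)
  have "?\<nu> \<le> \<eta> / (12 * alpha_max CARD('n) M * real CARD('m) * \<Lambda>)"
    unfolding nu_star_def by (rule Min_le) auto
  then show "12 * alpha_max CARD('n) M * real CARD('m) * \<Lambda> * ?\<nu> \<le> \<eta>"
    using pos by (simp add: pos_le_divide_eq mult.commute)
qed

text \<open>The endpoint serves the induction over iterates; the whole segment serves the Taylor
  bound at termination.\<close>

lemma strictly_feasible_step:
  assumes x: "\<And>i. f i x < 0" and "\<Lambda> > 0" "\<eta> > 0"
    and "szo_qq_step f0 f L M \<mu> \<Lambda> \<eta> k x y"
    and "w \<in> closed_segment x y"
  shows "f i w < 0"
  using assms strictly_feasible_local_feasible_set[OF x nu_star_bounds(1,2)[OF x]]
  by (auto simp: szo_qq_step_def is_arg_min_def)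

section \<open>From the termination residuals to the KKT residuals\<close>

lemma eta_KKT_pair_of_stop:
  assumes x: "\<And>i. f i x < 0" and \<Lambda>: "\<Lambda> > 0" and \<eta>: "\<eta> > 0" and \<mu>: "\<mu> > 0"
    and step: "szo_qq_step f0 f L M \<mu> \<Lambda> \<eta> k x y"
    and stop: "szo_qq_stops f0 f L M \<mu> \<Lambda> \<eta> (h_threshold CARD('n) L M \<mu> \<Lambda> \<eta>) k x y lam"
  shows "eta_KKT_pair \<eta> f0 f y lam"
proof -
  define \<nu> where "\<nu> = nu_star f L M \<Lambda> \<eta> k x"
  define s where "s = norm (y - x)"
  define a where "a = alpha_max CARD('n) M"
  define D where "D i = fd_gradient \<nu> (f i) x" for i
  note \<nu> = nu_star_bounds[OF x \<Lambda> \<eta>, of k, folded \<nu>_def a_def]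
  have SM: "0 < sum M UNIV" "M i \<le> sum M UNIV" for i
    by (auto intro!: sum_pos member_le_sum M_pos less_imp_le[OF M_pos])
  have a: "0 < a" "sqrt (real CARD('n)) * M i / 2 \<le> a" for i
    using alpha_max_pos[of "CARD('n)"] alpha_le_max[of "CARD('n)" i] by (simp_all add: a_def)
  have s0: "0 \<le> s" by (simp add: s_def)
  have "s \<le> h_threshold CARD('n) L M \<mu> \<Lambda> \<eta>"
    using stop by (simp add: szo_qq_stops_def s_def)
  then have "s \<le> \<eta> / (60 * \<Lambda> * sum M UNIV)" "s \<le> \<eta> / (12 * \<mu>)" and s1: "s \<le> 1"
    by (simp_all add: h_threshold_def)
  then have sM: "60 * (\<Lambda> * (s * sum M UNIV)) \<le> \<eta>" and s\<mu>: "12 * (\<mu> * s) \<le> \<eta>"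
    using \<Lambda> SM(1) \<mu> by (simp_all add: pos_le_divide_eq mult_ac)
  have seg: "closed_segment x y \<subseteq> feasible_set f"
    using strictly_feasible_step[OF x \<Lambda> \<eta> step] by (auto simp: feasible_set_def intro: less_imp_le)
  have lam0: "0 \<le> lam $ i" for i
    using stop by (simp add: szo_qq_stops_def szo_qq_multiplier_def is_arg_min_def)
  have lam_le: "lam $ i \<le> 2 * \<Lambda>" for i
    using stop component_le_infnorm_cart[of lam i] unfolding szo_qq_stops_def by linarith
  have "max (delta1 f0 f M \<mu> \<nu> x y lam) (Max (range (delta2 f M \<nu> x y lam))) \<le> \<eta> / 2"
    using stop unfolding szo_qq_stops_def szo_qq_multiplier_def is_arg_min_def \<nu>_def by blast
  then have d1: "delta1 f0 f M \<mu> \<nu> x y lam \<le> \<eta> / 2"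
    and dM: "Max (range (delta2 f M \<nu> x y lam)) \<le> \<eta> / 2"
    unfolding max.bounded_iff by blast+
  have d2: "delta2 f M \<nu> x y lam i \<le> \<eta> / 2" for i
    by (rule order_trans[OF Max_ge dM]) auto
  have fd: "norm (D i - gradient (f i) x) \<le> a * \<nu>" for i
    using fd_gradient_constraint_error[OF x \<nu>(1,2), of i]
      mult_right_mono[OF a(2)[of i] less_imp_le[OF \<nu>(1)]]
    unfolding D_def by linarith
  have gr: "norm (gradient (f i) y - gradient (f i) x) \<le> M i * s" for i
    using lipschitz_onD[OF gradient_lipschitz, of y x i] seg by (auto simp: dist_norm s_def)

  \<comment> \<open>\<open>E i\<close> is the error of the model gradient used in
    \<open>delta1\<close>. Its bound has \<open>5 * s * M i\<close>: one part from moving the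
    gradient from \<open>x\<close> to \<open>y\<close>, four from the derivative of the quadratic
    term.\<close>
  define E where "E i = gradient (f i) y - (D i + (4 * M i) *\<^sub>R (y - x))" for i
  have E: "norm (lam $ i *\<^sub>R E i) \<le> 2 * \<Lambda> * (5 * s * M i + a * \<nu>)" for i
  proof -
    have "E i = (gradient (f i) y - gradient (f i) x) - (D i - gradient (f i) x)
        - (4 * M i) *\<^sub>R (y - x)" by (simp add: E_def)
    then have "norm (E i) \<le> norm (gradient (f i) y - gradient (f i) x)
        + norm (D i - gradient (f i) x) + norm ((4 * M i) *\<^sub>R (y - x))"
      by (simp only:) (intro order_trans[OF norm_triangle_ineq4] add_right_mono norm_triangle_ineq4)
    moreover have "norm ((4 * M i) *\<^sub>R (y - x)) = 4 * M i * s"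
      using M_pos[of i] by (simp add: s_def)
    ultimately have "norm (E i) \<le> 5 * s * M i + a * \<nu>"
      using gr[of i] fd[of i] by (simp add: algebra_simps)
    then show ?thesis
      unfolding norm_scaleR abs_of_nonneg[OF lam0] using lam_le[of i] \<Lambda> by (intro mult_mono) auto
  qed
  have "norm (\<Sum>i\<in>UNIV. lam $ i *\<^sub>R E i) \<le> (\<Sum>i\<in>UNIV. 2 * \<Lambda> * (5 * s * M i + a * \<nu>))"
    by (intro sum_norm_le E)
  also have "\<dots> = 10 * (\<Lambda> * (s * sum M UNIV)) + 2 * a * real CARD('m) * \<Lambda> * \<nu>"
    by (simp add: sum.distrib distrib_left flip: sum_distrib_left)
  \<comment> \<open>The constants 60 in \<open>h_threshold\<close> and 12 in \<open>nu_star\<close>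
    each leave a share of one sixth.\<close>
  also have "\<dots> \<le> \<eta> / 6 + \<eta> / 6" using sM \<nu>(3) by linarith
  finally have sumE: "norm (\<Sum>i\<in>UNIV. lam $ i *\<^sub>R E i) \<le> \<eta> / 6 + \<eta> / 6" .

  define V where "V = gradient f0 y + (2 * \<mu>) *\<^sub>R (y - x)
    + (\<Sum>i\<in>UNIV. (lam $ i) *\<^sub>R (D i + (4 * M i) *\<^sub>R (y - x)))"
  have "gradient f0 y + (\<Sum>i\<in>UNIV. lam $ i *\<^sub>R gradient (f i) y)
      = V - (2 * \<mu>) *\<^sub>R (y - x) + (\<Sum>i\<in>UNIV. lam $ i *\<^sub>R E i)"
    unfolding V_def E_def
    by (simp add: scaleR_diff_right scaleR_add_right sum_subtractf sum.distrib)
  also have "norm \<dots> \<le> norm V + norm ((2 * \<mu>) *\<^sub>R (y - x)) + norm (\<Sum>i\<in>UNIV. lam $ i *\<^sub>R E i)"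
    by (rule order_trans[OF norm_triangle_ineq add_right_mono[OF norm_triangle_ineq4]])
  \<comment> \<open>Half of \<open>\<eta>\<close> is the termination tolerance; the proximal term,
    the step length and the sampling radius take one sixth each.\<close>
  also have "\<dots> \<le> \<eta> / 2 + \<eta> / 6 + (\<eta> / 6 + \<eta> / 6)"
    using d1 s\<mu> sumE \<mu> by (intro add_mono) (simp_all add: delta1_def V_def D_def s_def)
  finally have stationarity:
    "norm (gradient f0 y + (\<Sum>i\<in>UNIV. lam $ i *\<^sub>R gradient (f i) y)) \<le> \<eta>" by simp

  have complementarity: "\<bar>lam $ i * f i y\<bar> \<le> \<eta>" for i
  proof -
    define R where "R = f i y - local_model (f i) (M i) \<nu> x y"
    \<comment> \<open>The entry 1 in \<open>h_threshold\<close> lets the bound linear in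
      \<open>s\<close> control quadratic terms. In the estimate of \<open>R\<close>, 5/2 is 1/2 from
      the Taylor remainder plus 2 from the model.\<close>
    have "s\<^sup>2 \<le> s" using s0 s1 by (simp add: power2_eq_square mult_left_le)
    then have "M i * s\<^sup>2 \<le> sum M UNIV * s"
      using SM s0 M_pos[of i] by (intro mult_mono) (auto intro: less_imp_le)
    moreover have "sqrt (real CARD('n)) * M i / 2 * \<nu> * s \<le> a * \<nu> * 1"
      using a \<nu>(1) s0 s1 by (intro mult_mono) (auto intro: less_imp_le)
    moreover have "0 \<le> M i * s\<^sup>2" using M_pos[of i] by simp
    ultimately have R: "\<bar>R\<bar> \<le> a * \<nu> + 5 / 2 * (s * sum M UNIV)"
      using model_error[OF x \<nu>(1,2) seg, of i] unfolding R_def s_def[symmetric]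
      by (simp add: mult.commute[of s])
    have "\<bar>lam $ i * R\<bar> \<le> 2 * \<Lambda> * (a * \<nu> + 5 / 2 * (s * sum M UNIV))"
      unfolding abs_mult using R lam0[of i] lam_le[of i] \<Lambda> by (intro mult_mono) auto
    \<comment> \<open>The explicit factor 1 is a placeholder, raised next to the number of
      constraints so that the bound on \<open>\<nu>\<close> applies.\<close>
    also have "\<dots> = 2 * (a * 1 * \<Lambda> * \<nu>) + 5 * (\<Lambda> * (s * sum M UNIV))"
      by (simp add: algebra_simps)
    also have "a * 1 * \<Lambda> * \<nu> \<le> a * real CARD('m) * \<Lambda> * \<nu>"
      using a \<Lambda> \<nu>(1) by (intro mult_right_mono mult_left_mono) (auto simp: Suc_leI)
    finally have "\<bar>lam $ i * R\<bar> \<le> \<eta> / 2" using sM \<nu>(3) \<eta> by linarith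
    moreover have "lam $ i * f i y = lam $ i * local_model (f i) (M i) \<nu> x y + lam $ i * R"
      by (simp add: R_def algebra_simps)
    ultimately show ?thesis using d2[of i] unfolding delta2_def by linarith
  qed
  show ?thesis
    unfolding eta_KKT_pair_def using seg lam0 stationarity complementarity by auto
qed

end

theorem theorem3:
  fixes f0 :: "real^'n \<Rightarrow> real" and f :: "'m::finite \<Rightarrow> real^'n \<Rightarrow> real"
    and L0 M0 :: real and L M :: "'m \<Rightarrow> real"
    and \<Omega>bar :: "(real^'n) set"
    and x0 xc xt :: "real^'n" and X :: "nat \<Rightarrow> real^'n"
    and \<beta> \<mu> \<Lambda> \<eta> \<xi> :: real
    and lamt :: "real^'m" and kt :: nat
  assumes "continuously_differentiable f0" and "linear f0"
    and "\<And>i. continuously_differentiable (f i)"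
    and "feasible_set f \<subseteq> \<Omega>bar"
    and "smoothness_constants (feasible_set f) \<Omega>bar f0 L0 M0"
    and "\<And>i. smoothness_constants (feasible_set f) \<Omega>bar (f i) (L i) (M i)"
    and "\<And>i. f i x0 < 0"
    and "bounded {x \<in> feasible_set f. f0 x \<le> \<beta>}"
    and "x0 \<in> {x \<in> feasible_set f. f0 x \<le> \<beta>}"
    and "\<mu> > 0" and "\<Lambda> > 0" and "\<eta> > 0" and "\<xi> > 0"
    and "szo_qq_iterates f0 f L M \<mu> \<Lambda> \<eta> x0 X"
    and "accumulation_point X xc" and "LICQ f xc"
    and "\<xi> = h_threshold CARD('n) L M \<mu> \<Lambda> \<eta>"
    and "szo_qq_output f0 f L M \<mu> \<Lambda> \<eta> \<xi> x0 xt lamt kt"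
  shows "eta_KKT_pair \<eta> f0 f xt lamt"
proof -
  interpret smooth_constraints f L M
    using assms(3,6)
    by unfold_locales (auto simp: continuously_differentiable_def smoothness_constants_def
        intro: lipschitz_on_subset[OF _ assms(4)])
  from assms(18) obtain Y k where Y0: "Y 0 = x0"
    and Y: "\<And>j. j \<le> k \<Longrightarrow> szo_qq_step f0 f L M \<mu> \<Lambda> \<eta> j (Y j) (Y (Suc j))"
    and stop: "szo_qq_stops f0 f L M \<mu> \<Lambda> \<eta> \<xi> k (Y k) (Y (Suc k)) lamt"
    and xt: "xt = Y (Suc k)"
    unfolding szo_qq_output_def by blast
  \<comment> \<open>The invariant must be strict: it makes the next sampling radius
    positive.\<close>
  have "j \<le> k \<Longrightarrow> f i (Y j) < 0" for i j
  proof (induction j arbitrary: i)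
    case 0
    then show ?case using assms(7) Y0 by simp
  next
    case (Suc j)
    then show ?case
      using strictly_feasible_step[OF _ \<open>\<Lambda> > 0\<close> \<open>\<eta> > 0\<close> Y ends_in_segment(2)] by simp
  qed
  then show ?thesis
    unfolding xt using eta_KKT_pair_of_stop[OF _ \<open>\<Lambda> > 0\<close> \<open>\<eta> > 0\<close> \<open>\<mu> > 0\<close> Y] stop assms(17)
    by blast
qed

end
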